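(* Let $\alpha\ge1$ be an integer and let $c_\alpha(x)=\sum_{k\ge0}\frac{1}{\alpha k+1}\binom{(\alpha+1)k}{k}x^k$. For $A,B\in\{E,N\}$ let $f_{ab}(x)=\sum_{k\ge1}a_kx^k$, where $a_k$ is the number of $AB$-paths from $(0,0)$ to $(\alpha k,k)$ that are bounce-free with respect to the line $y=\frac{1}{\alpha}x$. Then, as formal power series, $$f_{ee}(x)=\frac{(\alpha c_\alpha(x)-1)(c_\alpha(x)-1)}{(1-\alpha)c_\alpha(x)^2+(\alpha+1)c_\alpha(x)-1},$$ $$f_{nn}(x)=\frac{(c_\alpha(x)-1)^2}{(1-\alpha)c_\alpha(x)^2+(\alpha+1)c_\alpha(x)-1},$$ $$f_{en}(x)=\frac{c_\alpha(x)(c_\alpha(x)-1)}{(1-\alpha)c_\alpha(x)^2+(\alpha+1)c_\alpha(x)-1}.$$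
   Context: Paths are lattice paths from $(0,0)$ to $(\alpha k,k)$, $k\ge1$, with unit East steps $E=(1,0)$ and unit North steps $N=(0,1)$. For $A,B\in\{E,N\}$, an $AB$-path is such a path whose first step is $A$ and whose last step is $B$. A left bounce of a path is an interior vertex of the path that lies on the line $y=\frac{1}{\alpha}x$ (hence is a point $(\alpha i,i)$ with $0<i<k$) at which the path arrives by an $E$-step and leaves by an $N$-step; a right bounce is such a vertex at which the path arrives by an $N$-step and leaves by an $E$-step. A path is bounce-free if it has no left bounces and no right bounces. *)

theory Defs
  imports "HOL-Computational_Algebra.Formal_Power_Series"
begin

datatype step = East | North

text \<open>A lattice path starting at the origin is the list of its steps.\<close>

definition vertex :: "step list \<Rightarrow> nat \<Rightarrow> nat \<times> nat" where
  "vertex p i = (count_list (take i p) East, count_list (take i p) North)"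

definition lattice_paths :: "nat \<Rightarrow> nat \<Rightarrow> step list set" where
  "lattice_paths m n = {p. vertex p (length p) = (m, n)}"

text \<open>The line \<open>y = x / \<alpha>\<close>, with the denominator cleared.\<close>

definition on_line :: "nat \<Rightarrow> nat \<times> nat \<Rightarrow> bool" where
  "on_line \<alpha> v \<longleftrightarrow> \<alpha> * snd v = fst v"

text \<open>The interior vertices are those reached after \<open>i\<close> steps with \<open>0 < i < length p\<close>;
  the path arrives there by step \<open>p ! (i - 1)\<close> and leaves by step \<open>p ! i\<close>.\<close>

definition left_bounce :: "nat \<Rightarrow> step list \<Rightarrow> nat \<Rightarrow> bool" where
  "left_bounce \<alpha> p i \<longleftrightarrow> 0 < i \<and> i < length p \<and> on_line \<alpha> (vertex p i)
     \<and> p ! (i - 1) = East \<and> p ! i = North"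

definition right_bounce :: "nat \<Rightarrow> step list \<Rightarrow> nat \<Rightarrow> bool" where
  "right_bounce \<alpha> p i \<longleftrightarrow> 0 < i \<and> i < length p \<and> on_line \<alpha> (vertex p i)
     \<and> p ! (i - 1) = North \<and> p ! i = East"

definition bounce_free :: "nat \<Rightarrow> step list \<Rightarrow> bool" where
  "bounce_free \<alpha> p \<longleftrightarrow> (\<forall>i. \<not> left_bounce \<alpha> p i \<and> \<not> right_bounce \<alpha> p i)"

definition AB_paths :: "nat \<Rightarrow> step \<Rightarrow> step \<Rightarrow> nat \<Rightarrow> step list set" where
  "AB_paths \<alpha> A B k = {p \<in> lattice_paths (\<alpha> * k) k. hd p = A \<and> last p = B}"

definition bounce_free_gf :: "nat \<Rightarrow> step \<Rightarrow> step \<Rightarrow> rat fps" where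
  "bounce_free_gf \<alpha> A B =
     Abs_fps (\<lambda>k. if k = 0 then 0 else of_nat (card {p \<in> AB_paths \<alpha> A B k. bounce_free \<alpha> p}))"

definition fuss_catalan_gf :: "nat \<Rightarrow> rat fps" where
  "fuss_catalan_gf \<alpha> = Abs_fps (\<lambda>k. 1 / of_nat (\<alpha> * k + 1) * of_nat (((\<alpha> + 1) * k) choose k))"

end

(* Cutting a path at its first bounce shows that the matrix P of generating functions of all
   AB-paths and the matrix F of the bounce-free ones satisfy P = F + F J P, where J exchanges
   the two kinds of steps: a bounce is precisely a vertex on the line at which the step changes.
   The entries of P are series of the form sum_k binom((alpha+1)k + r, k) x^k up to a power of x,
   and Pascal's rule identifies this series as c^r times the one for r = 0. *)

theory Submission
  imports Defs
begin

unbundle fps_syntax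

section \<open>Fuss--Catalan series\<close>

definition binomial_gf :: "nat \<Rightarrow> nat \<Rightarrow> rat fps" where
  "binomial_gf t r = Abs_fps (\<lambda>k. of_nat ((t * k + r) choose k))"

text \<open>Pascal's rule, with \<open>t * (k + 1) + r = t * k + (r + t)\<close>: the second
  binomial of the rule is the previous coefficient of the series with index \<open>r + t\<close>,
  hence the factor \<open>fps_X\<close>.\<close>

lemma binomial_gf_Suc:
  "binomial_gf t (Suc r) = binomial_gf t r + fps_X * binomial_gf t (r + t)"
proof (rule fps_ext)
  fix n
  show "binomial_gf t (Suc r) $ n = (binomial_gf t r + fps_X * binomial_gf t (r + t)) $ n"
    by (cases n) (simp_all add: binomial_gf_def algebra_simps)
qed

text \<open>The series \<open>B ^ r * G 0\<close> obeys the same recurrence and agrees with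
  \<open>G\<close> at \<open>r = 0\<close>. The recurrence has only one solution with given
  \<open>G 0\<close>: since \<open>fps_X\<close> shifts, coefficient \<open>n\<close> at
  \<open>Suc r\<close> needs coefficient \<open>n\<close> at \<open>r\<close> and coefficient
  \<open>n - 1\<close> at \<open>r + t\<close>. This is the outer induction on \<open>n\<close> and
  the inner one on \<open>r\<close>.\<close>

lemma fps_recurrence_power:
  fixes B :: "'a :: comm_ring_1 fps"
  assumes B: "B = 1 + fps_X * B ^ t"
    and G: "\<And>r. G (Suc r) = G r + fps_X * G (r + t)"
  shows "G r = B ^ r * G 0"
proof -
  define H where "H r = B ^ r * G 0" for r
  have H: "H (Suc r) = H r + fps_X * H (r + t)" for r
  proof -
    have "H (Suc r) = B ^ r * B * G 0" by (simp add: H_def mult_ac)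
    also have "\<dots> = B ^ r * (1 + fps_X * B ^ t) * G 0" using B by simp
    also have "\<dots> = H r + fps_X * H (r + t)" by (simp add: H_def algebra_simps power_add)
    finally show ?thesis .
  qed
  have "G r $ n = H r $ n" for n
  proof (induction n arbitrary: r)
    case 0
    show ?case by (induction r) (simp_all add: G H, simp add: H_def)
  next
    case (Suc n)
    show ?case by (induction r) (simp_all add: G H Suc, simp add: H_def)
  qed
  then show ?thesis by (simp add: H_def fps_ext)
qed

text \<open>The compositional inverse \<open>g\<close> of x / (1 + x)^t satisfies g = x (1 + g)^t,
  so \<open>1 + g\<close> is a fixed point. Its coefficients are not computed here; the solution is
  identified later through linear relations.\<close>

lemma exists_fps_fixpoint:
  "\<exists>B :: 'a :: field fps. B = 1 + fps_X * B ^ t"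
proof -
  define a :: "'a fps" where "a = fps_X * inverse ((1 + fps_X) ^ t)"
  define g where "g = fps_inv a"
  have a0: "a $ 0 = 0" by (simp add: a_def)
  have a1: "a $ 1 \<noteq> 0" by (simp add: a_def)
  have g0: "g $ 0 = 0" by (simp add: g_def fps_inv_def)
  have "fps_X = a oo g" using fps_inv_right[OF a0 a1] by (simp add: g_def)
  also have "\<dots> = g * inverse ((1 + g) ^ t)"
    by (simp add: a_def fps_compose_mult_distrib[OF g0] fps_inverse_compose[OF g0]
        fps_compose_power[OF g0, symmetric] fps_compose_add_distrib g0)
  finally have "fps_X * (1 + g) ^ t = g * (inverse ((1 + g) ^ t) * (1 + g) ^ t)"
    by (simp add: mult.assoc)
  also have "inverse ((1 + g) ^ t) * (1 + g) ^ t = 1"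
    by (rule inverse_mult_eq_1) (simp add: g0)
  finally have "1 + g = 1 + fps_X * (1 + g) ^ t" by simp
  then show ?thesis by blast
qed

text \<open>The recurrence in \<open>r\<close> leaves the series for \<open>r = 0\<close> free. The
  absorption identity supplies the missing inhomogeneous relation: for the upper index (a+1)(k+1)
  the factor k+1 cancels on both sides.\<close>

lemma binomial_gf_0_absorb:
  "binomial_gf (Suc a) 0 = 1 + of_nat (Suc a) * fps_X * binomial_gf (Suc a) a"
proof (rule fps_ext)
  fix n
  show "binomial_gf (Suc a) 0 $ n = (1 + of_nat (Suc a) * fps_X * binomial_gf (Suc a) a) $ n"
  proof (cases n)
    case (Suc k)
    let ?N = "Suc a * Suc k"
    have "Suc k * (?N choose Suc k) = ?N * ((?N - 1) choose k)"
      by (rule binomial_absorption)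
    then have "Suc k * (?N choose Suc k) = Suc k * (Suc a * ((?N - 1) choose k))"
      by (simp only: mult_ac)
    then have "?N choose Suc k = Suc a * ((?N - 1) choose k)"
      by (rule Suc_mult_cancel1[THEN iffD1])
    moreover have "?N - 1 = Suc a * k + a" by (simp add: algebra_simps)
    ultimately have "?N choose Suc k = Suc a * ((Suc a * k + a) choose k)" by (simp only:)
    then have "(of_nat (?N choose Suc k) :: rat) = of_nat (Suc a) * of_nat ((Suc a * k + a) choose k)"
      by (metis of_nat_mult)
    then show ?thesis unfolding Suc
      by (simp add: binomial_gf_def fps_of_nat[symmetric] mult.assoc del: of_nat_Suc mult_Suc)
  qed (simp add: binomial_gf_def)
qed

text \<open>For N = (a+1)n the ratio of binom(N, n-1) to binom(N, n) is n / (an+1), so the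
  difference binom(N, n) - a binom(N, n-1) is binom(N, n) / (an+1).\<close>

lemma fuss_catalan_gf_eq_binomial_gf:
  "fuss_catalan_gf a = binomial_gf (Suc a) 0 - of_nat a * fps_X * binomial_gf (Suc a) (Suc a)"
proof (rule fps_ext)
  fix n
  show "fuss_catalan_gf a $ n =
      (binomial_gf (Suc a) 0 - of_nat a * fps_X * binomial_gf (Suc a) (Suc a)) $ n"
  proof (cases n)
    case (Suc k)
    let ?N = "Suc a * Suc k"
    define u v where "u = (of_nat (?N choose Suc k) :: rat)" and "v = (of_nat (?N choose k) :: rat)"
    have "Suc k * (?N choose Suc k) = (?N - k) * (?N choose k)"
      by (metis binomial_absorb_comp binomial_absorption)
    moreover have "?N - k = a * Suc k + 1" by (simp add: algebra_simps)
    moreover define d where "d = (of_nat (a * Suc k + 1) :: rat)"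
    ultimately have "of_nat (Suc k) * u = d * v"
      unfolding u_def v_def d_def by (metis of_nat_mult)
    then have "d * (u - of_nat a * v) = (d - of_nat a * of_nat (Suc k)) * u"
      by (simp add: algebra_simps del: of_nat_Suc)
    also have "\<dots> = u" by (simp add: d_def algebra_simps)
    finally have "d * (u - of_nat a * v) = u" .
    moreover have "d \<noteq> 0" unfolding d_def by (simp del: of_nat_mult of_nat_Suc of_nat_add)
    ultimately have "1 / of_nat (a * Suc k + 1) * u = u - of_nat a * v"
      by (metis d_def mult.commute mult.right_neutral nonzero_mult_div_cancel_left times_divide_eq_right)
    moreover have "fuss_catalan_gf a $ n = 1 / of_nat (a * Suc k + 1) * u"
      by (simp only: fuss_catalan_gf_def fps_nth_Abs_fps Suc u_def Suc_eq_plus1)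
    moreover have "Suc a * k + Suc a = ?N" by simp
    then have "binomial_gf (Suc a) (Suc a) $ k = v" "binomial_gf (Suc a) 0 $ n = u"
      by (simp_all only: binomial_gf_def u_def v_def fps_nth_Abs_fps Suc add_0_right)
    ultimately show ?thesis
      by (simp add: Suc fps_of_nat[symmetric] mult.assoc del: of_nat_Suc)
  qed (simp add: binomial_gf_def fuss_catalan_gf_def)
qed

text \<open>Take any fixed point \<open>B\<close>. All binomial series are then
  \<open>B ^ r * A\<close>; absorption gives A (1 + a - aB) = B, and the binomial form of the
  Fuss-Catalan series gives the same product. Hence that series is \<open>B\<close>.\<close>

lemma fuss_catalan_gf_fixpoint:
  shows fuss_catalan_gf_rec: "fuss_catalan_gf a = 1 + fps_X * fuss_catalan_gf a ^ Suc a"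
    and binomial_gf_eq_power: "binomial_gf (Suc a) r = fuss_catalan_gf a ^ r * binomial_gf (Suc a) 0"
    and binomial_gf_0_eq:
      "binomial_gf (Suc a) 0 * (1 + of_nat a - of_nat a * fuss_catalan_gf a) = fuss_catalan_gf a"
proof -
  obtain B :: "rat fps" where B: "B = 1 + fps_X * B ^ Suc a"
    using exists_fps_fixpoint by blast
  define A where "A = binomial_gf (Suc a) 0"
  have pow: "binomial_gf (Suc a) r = B ^ r * A" for r
    unfolding A_def by (rule fps_recurrence_power[OF B binomial_gf_Suc])
  have XB: "fps_X * B ^ Suc a = B - 1" using B by (simp add: algebra_simps)
  have "A = 1 + of_nat (Suc a) * fps_X * (B ^ a * A)"
    using binomial_gf_0_absorb[of a] by (simp add: pow)
  \<comment> \<open>The factor \<open>B\<close> completes \<open>fps_X * B ^ a\<close> to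
    \<open>fps_X * B ^ Suc a\<close>, which equals \<open>B - 1\<close>.\<close>
  then have "B * A = B * (1 + of_nat (Suc a) * fps_X * (B ^ a * A))"
    by (rule arg_cong)
  also have "\<dots> = B + of_nat (Suc a) * (fps_X * B ^ Suc a) * A"
    by (simp add: distrib_left mult_ac del: of_nat_Suc)
  finally have "B * A = B + of_nat (Suc a) * (fps_X * B ^ Suc a) * A" .
  then have AB: "A * (1 + of_nat a - of_nat a * B) = B"
    unfolding XB by (simp add: algebra_simps)
  have "fuss_catalan_gf a = A - of_nat a * (fps_X * B ^ Suc a) * A"
    unfolding fuss_catalan_gf_eq_binomial_gf pow[of "Suc a"] pow[of 0] by (simp add: mult_ac)
  also have "\<dots> = A * (1 + of_nat a - of_nat a * B)"
    unfolding XB by (simp add: algebra_simps)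
  finally have c: "fuss_catalan_gf a = B" using AB by simp
  show "fuss_catalan_gf a = 1 + fps_X * fuss_catalan_gf a ^ Suc a"
    "binomial_gf (Suc a) r = fuss_catalan_gf a ^ r * binomial_gf (Suc a) 0"
    "binomial_gf (Suc a) 0 * (1 + of_nat a - of_nat a * fuss_catalan_gf a) = fuss_catalan_gf a"
    unfolding c A_def[symmetric] by (fact B pow AB)+
qed

section \<open>Counting lattice paths\<close>

lemma step_neq_iff: "s \<noteq> East \<longleftrightarrow> s = North" "s \<noteq> North \<longleftrightarrow> s = East"
  by (cases s; simp)+

lemma UNIV_step: "(UNIV :: step set) = {East, North}"
  by (auto simp: step_neq_iff)

lemma lattice_paths_iff:
  "p \<in> lattice_paths m n \<longleftrightarrow> count_list p East = m \<and> count_list p North = n"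
  by (simp add: lattice_paths_def vertex_def)

lemma length_eq_count_steps: "length p = count_list p East + count_list p North"
proof (induction p)
  case (Cons s p)
  then show ?case by (cases s) auto
qed simp

lemma finite_lattice_paths: "finite (lattice_paths m n)"
proof (rule finite_subset)
  have fin: "finite (UNIV :: step set)"
    by (simp add: UNIV_step)
  show "finite {p :: step list. set p \<subseteq> UNIV \<and> length p = m + n}"
    by (rule finite_lists_length_eq[OF fin])
  show "lattice_paths m n \<subseteq> {p. set p \<subseteq> UNIV \<and> length p = m + n}"
    using length_eq_count_steps by (auto simp: lattice_paths_iff)
qed

lemma lattice_paths_Suc_Suc:
  "lattice_paths (Suc m) (Suc n) =
     Cons East ` lattice_paths m (Suc n) \<union> Cons North ` lattice_paths (Suc m) n"
proof (rule set_eqI)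
  fix p
  show "p \<in> lattice_paths (Suc m) (Suc n) \<longleftrightarrow>
      p \<in> Cons East ` lattice_paths m (Suc n) \<union> Cons North ` lattice_paths (Suc m) n"
  proof (cases p)
    case (Cons s q)
    then show ?thesis by (cases s) (auto simp: lattice_paths_iff)
  qed (auto simp: lattice_paths_iff)
qed

lemma lattice_paths_0_right: "lattice_paths m 0 = {replicate m East}"
proof -
  have "count_list p East = m \<and> count_list p North = 0 \<longleftrightarrow> p = replicate m East" for p
  proof (induction p arbitrary: m)
    case (Cons s p)
    then show ?case by (cases s; cases m) auto
  qed auto
  then show ?thesis by (intro set_eqI) (simp only: lattice_paths_iff singleton_iff)
qed

lemma lattice_paths_0_left: "lattice_paths 0 n = {replicate n North}"
proof -
  have "count_list p East = 0 \<and> count_list p North = n \<longleftrightarrow> p = replicate n North" for p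
  proof (induction p arbitrary: n)
    case (Cons s p)
    then show ?case by (cases s; cases n) auto
  qed auto
  then show ?thesis by (intro set_eqI) (simp only: lattice_paths_iff singleton_iff)
qed

lemma card_lattice_paths: "card (lattice_paths m n) = (m + n) choose n"
proof (induction "m + n" arbitrary: m n)
  case 0
  then show ?case by (simp add: lattice_paths_0_left)
next
  case (Suc s)
  show ?case
  proof (cases "m = 0 \<or> n = 0")
    case True
    then show ?thesis by (auto simp: lattice_paths_0_left lattice_paths_0_right)
  next
    case False
    then obtain m' n' where mn: "m = Suc m'" "n = Suc n'" by (meson not0_implies_Suc)
    have "card (lattice_paths m n) = card (lattice_paths m' (Suc n')) + card (lattice_paths (Suc m') n')"
      unfolding mn lattice_paths_Suc_Suc
      by (subst card_Un_disjoint) (auto simp: finite_lattice_paths card_image)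
    also have "\<dots> = ((m' + Suc n') choose Suc n') + ((Suc m' + n') choose n')"
      using Suc(1)[of m' "Suc n'"] Suc(1)[of "Suc m'" n'] Suc(2) mn by simp
    finally show ?thesis by (simp add: mn)
  qed
qed

section \<open>Counting paths with prescribed first and last steps\<close>

lemma finite_AB_paths: "finite (AB_paths \<alpha> A B k)"
  by (simp add: AB_paths_def finite_lattice_paths)

text \<open>The head and last element of the empty list are unspecified, so trimming both end steps
  needs the path to have at least two steps.\<close>

lemma paths_with_ends:
  assumes "2 \<le> m + n"
  shows "{p \<in> lattice_paths m n. hd p = A \<and> last p = B} =
    (\<lambda>p. A # p @ [B]) ` {p. count_list [A, B] East + count_list p East = m
      \<and> count_list [A, B] North + count_list p North = n}"
proof (intro equalityI subsetI)
  fix p assume p: "p \<in> {p \<in> lattice_paths m n. hd p = A \<and> last p = B}"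
  then have "2 \<le> length p" using assms length_eq_count_steps[of p] by (auto simp: lattice_paths_iff)
  then obtain a q where q: "p = a # q" "q \<noteq> []" by (cases p) (auto simp: Suc_le_length_iff)
  then obtain r b where "q = r @ [b]" by (metis append_butlast_last_id)
  with p q have "p = A # r @ [B]" by auto
  with p show "p \<in> (\<lambda>p. A # p @ [B]) ` {p. count_list [A, B] East + count_list p East = m
      \<and> count_list [A, B] North + count_list p North = n}"
    by (auto simp: lattice_paths_iff)
qed (auto simp: lattice_paths_iff)

text \<open>Trimming both ends leaves an unrestricted path. Writing the endpoint as the contribution
  of the two end steps plus a remainder avoids subtraction of naturals.\<close>

lemma card_paths_with_ends:
  assumes "count_list [A, B] East + m + (count_list [A, B] North + n) \<ge> 2"
  shows "card {p \<in> lattice_paths (count_list [A, B] East + m) (count_list [A, B] North + n).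
    hd p = A \<and> last p = B} = (m + n) choose n"
proof -
  have "{p. count_list [A, B] East + count_list p East = count_list [A, B] East + m
      \<and> count_list [A, B] North + count_list p North = count_list [A, B] North + n} = lattice_paths m n"
    by (auto simp: lattice_paths_iff)
  then show ?thesis
    by (subst paths_with_ends[OF assms]) (simp add: card_image inj_on_def card_lattice_paths)
qed


text \<open>Coefficient 0 is forced to be 0, as in \<open>bounce_free_gf\<close>, because the end
  steps of the empty path are unspecified.\<close>

definition AB_gf :: "nat \<Rightarrow> step \<Rightarrow> step \<Rightarrow> rat fps" where
  "AB_gf \<alpha> A B = Abs_fps (\<lambda>k. if k = 0 then 0 else of_nat (card (AB_paths \<alpha> A B k)))"

lemma AB_gf_mixed:
  assumes "\<alpha> \<ge> 1" "A \<noteq> B"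
  shows "AB_gf \<alpha> A B = fps_X * binomial_gf (Suc \<alpha>) (\<alpha> - 1)"
proof (rule fps_ext)
  fix n
  show "AB_gf \<alpha> A B $ n = (fps_X * binomial_gf (Suc \<alpha>) (\<alpha> - 1)) $ n"
  proof (cases n)
    case (Suc k)
    have ends: "count_list [A, B] East = 1" "count_list [A, B] North = 1"
      using assms(2) by (cases A; cases B; simp)+
    have m: "1 + (\<alpha> * Suc k - 1) = \<alpha> * Suc k" using assms(1) by simp
    have "card (AB_paths \<alpha> A B (Suc k)) = (\<alpha> * Suc k - 1 + k) choose k"
      using card_paths_with_ends[of A B "\<alpha> * Suc k - 1" k]
      unfolding ends AB_paths_def m using assms(1) by simp
    also have "\<alpha> * Suc k - 1 + k = Suc \<alpha> * k + (\<alpha> - 1)" using assms(1) by simp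
    finally show ?thesis by (simp add: Suc AB_gf_def binomial_gf_def)
  qed (simp add: AB_gf_def)
qed

lemma AB_gf_North_North:
  assumes "\<alpha> \<ge> 1"
  shows "AB_gf \<alpha> North North = fps_X ^ 2 * binomial_gf (Suc \<alpha>) (2 * \<alpha>)"
proof (rule fps_ext)
  fix n
  consider "n = 0" | "n = 1" | k where "n = Suc (Suc k)" by (metis One_nat_def not0_implies_Suc)
  then show "AB_gf \<alpha> North North $ n = (fps_X ^ 2 * binomial_gf (Suc \<alpha>) (2 * \<alpha>)) $ n"
  proof cases
    case 2
    \<comment> \<open>As \<open>\<alpha> \<ge> 1\<close>, such a path has at least two steps, so its
      only North step cannot be both first and last.\<close>
    have "AB_paths \<alpha> North North 1 = {}"
      using paths_with_ends[of "\<alpha> * 1" 1 North North] assms by (simp add: AB_paths_def)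
    then show ?thesis by (simp add: 2 AB_gf_def fps_X_power_mult_nth)
  next
    case (3 k)
    have "card (AB_paths \<alpha> North North n) = (\<alpha> * n + k) choose k"
      using card_paths_with_ends[of North North "\<alpha> * n" k] by (simp add: AB_paths_def 3)
    also have "\<alpha> * n + k = Suc \<alpha> * k + 2 * \<alpha>" by (simp add: 3)
    finally show ?thesis by (simp add: 3 AB_gf_def binomial_gf_def fps_X_power_mult_nth)
  qed (simp add: AB_gf_def fps_X_power_mult_nth)
qed

text \<open>This determines the East-East series by subtraction. A direct count would lead to
  binom((\<alpha>+1)k - 2, k), that is to index -2, outside the range of \<open>binomial_gf\<close>.
  The 1 removes the empty path.\<close>

lemma AB_gf_total:
  "AB_gf \<alpha> East East + AB_gf \<alpha> East North + AB_gf \<alpha> North East + AB_gf \<alpha> North North =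
    binomial_gf (Suc \<alpha>) 0 - 1"
proof (rule fps_ext)
  fix n
  let ?c = "\<lambda>A B. card (AB_paths \<alpha> A B n)"
  have card_row: "card (AB_paths \<alpha> A East n \<union> AB_paths \<alpha> A North n) = ?c A East + ?c A North" for A
    by (rule card_Un_disjoint[OF finite_AB_paths finite_AB_paths]) (auto simp: AB_paths_def)
  have "lattice_paths (\<alpha> * n) n = (AB_paths \<alpha> East East n \<union> AB_paths \<alpha> East North n) \<union>
      (AB_paths \<alpha> North East n \<union> AB_paths \<alpha> North North n)"
    by (auto simp: AB_paths_def step_neq_iff)
  also have "card \<dots> = (?c East East + ?c East North) + (?c North East + ?c North North)"
    unfolding card_row[symmetric] by (rule card_Un_disjoint) (simp_all add: finite_AB_paths, auto simp: AB_paths_def)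
  finally have "?c East East + ?c East North + ?c North East + ?c North North = (\<alpha> * n + n) choose n"
    by (simp add: card_lattice_paths)
  then have "of_nat (?c East East) + of_nat (?c East North) + of_nat (?c North East) +
      of_nat (?c North North) = (of_nat ((\<alpha> * n + n) choose n) :: rat)"
    by (metis of_nat_add)
  then show "(AB_gf \<alpha> East East + AB_gf \<alpha> East North + AB_gf \<alpha> North East + AB_gf \<alpha> North North) $ n =
      (binomial_gf (Suc \<alpha>) 0 - 1) $ n"
    by (simp add: AB_gf_def binomial_gf_def add.commute)
qed

section \<open>Decomposition at the first bounce\<close>

definition bounce :: "nat \<Rightarrow> step list \<Rightarrow> nat \<Rightarrow> bool" where
  "bounce \<alpha> p i \<longleftrightarrow> 0 < i \<and> i < length p \<and> on_line \<alpha> (vertex p i) \<and> p ! (i - 1) \<noteq> p ! i"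

lemma bounce_free_iff: "bounce_free \<alpha> p \<longleftrightarrow> (\<forall>i. \<not> bounce \<alpha> p i)"
proof -
  have "bounce \<alpha> p i \<longleftrightarrow> left_bounce \<alpha> p i \<or> right_bounce \<alpha> p i" for i
    unfolding left_bounce_def right_bounce_def bounce_def
    by (cases "p ! (i - 1)"; cases "p ! i") simp_all
  then show ?thesis by (simp add: bounce_free_def)
qed

primrec opposite :: "step \<Rightarrow> step" where
  "opposite East = North"
| "opposite North = East"

lemma opposite_eq_iff: "opposite A = B \<longleftrightarrow> A \<noteq> B"
  by (cases A; cases B) auto

text \<open>A bounce at \<open>i\<close> depends only on the first \<open>i + 1\<close> steps, all
  of which lie in \<open>q\<close>.\<close>

lemma bounce_append:
  assumes "i < length q"
  shows "bounce \<alpha> (q @ r) i \<longleftrightarrow> bounce \<alpha> q i"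
  using assms by (auto simp: bounce_def vertex_def nth_append)

lemma AB_paths_iff:
  "p \<in> AB_paths \<alpha> A B k \<longleftrightarrow>
    count_list p East = \<alpha> * k \<and> count_list p North = k \<and> hd p = A \<and> last p = B"
  by (auto simp: AB_paths_def lattice_paths_iff)

lemma AB_paths_nonempty: "p \<in> AB_paths \<alpha> A B k \<Longrightarrow> 0 < k \<Longrightarrow> p \<noteq> []"
  by (auto simp: AB_paths_iff)

text \<open>The junction is the endpoint of \<open>q\<close>, hence on the line, so it is a bounce
  exactly when the step changes there. Positivity of \<open>j\<close> and \<open>l\<close> makes
  both pieces nonempty, so their end steps are genuine.\<close>

lemma AB_paths_append:
  assumes "q \<in> AB_paths \<alpha> A C j" "r \<in> AB_paths \<alpha> D B l" "0 < j" "0 < l"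
  shows "q @ r \<in> AB_paths \<alpha> A B (j + l)"
    and "bounce \<alpha> (q @ r) (length q) \<longleftrightarrow> C \<noteq> D"
proof -
  have ne: "q \<noteq> []" "r \<noteq> []" using AB_paths_nonempty assms by blast+
  show "q @ r \<in> AB_paths \<alpha> A B (j + l)"
    using assms ne by (simp add: AB_paths_iff algebra_simps)
  have "(q @ r) ! (length q - 1) = C"
    using ne assms(1) by (simp add: nth_append last_conv_nth AB_paths_iff)
  moreover have "(q @ r) ! length q = D"
    using ne assms(2) by (simp add: nth_append hd_conv_nth AB_paths_iff)
  ultimately show "bounce \<alpha> (q @ r) (length q) \<longleftrightarrow> C \<noteq> D"
    using ne assms(1) by (simp add: bounce_def on_line_def vertex_def AB_paths_iff)
qed

abbreviation bounce_free_AB_paths :: "nat \<Rightarrow> step \<Rightarrow> step \<Rightarrow> nat \<Rightarrow> step list set" where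
  "bounce_free_AB_paths \<alpha> A B k \<equiv> {p \<in> AB_paths \<alpha> A B k. bounce_free \<alpha> p}"

text \<open>The inverse map cuts a path at its first bounce: the initial piece is bounce-free, while
  the final piece may bounce again and starts with the step opposite to the last one before the
  cut.\<close>

lemma first_bounce_bij_betw:
  "bij_betw (\<lambda>((j, C), (q, r)). q @ r)
     (SIGMA (j, C) : {1..<k} \<times> UNIV.
        bounce_free_AB_paths \<alpha> A C j \<times> AB_paths \<alpha> (opposite C) B (k - j))
     {p \<in> AB_paths \<alpha> A B k. \<not> bounce_free \<alpha> p}"
  (is "bij_betw ?f ?S ?T")
proof (rule bij_betw_imageI)
  \<comment> \<open>All data can be recovered from \<open>q @ r\<close>: the least bounce is
    \<open>length q\<close>, and \<open>q\<close> determines \<open>j\<close> and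
    \<open>C\<close>.\<close>
  have split: "bounce \<alpha> (q @ r) (length q) \<and> (\<forall>i<length q. \<not> bounce \<alpha> (q @ r) i)
      \<and> count_list q North = j \<and> last q = C \<and> q @ r \<in> AB_paths \<alpha> A B k"
    if "((j, C), (q, r)) \<in> ?S" for j C q r
  proof -
    from that have q: "q \<in> AB_paths \<alpha> A C j" "bounce_free \<alpha> q"
      and r: "r \<in> AB_paths \<alpha> (opposite C) B (k - j)" and j: "0 < j" "j < k" by auto
    have "0 < k - j" using j by simp
    note app = AB_paths_append[OF q(1) r j(1) this]
    have "C \<noteq> opposite C" by (cases C) auto
    then show ?thesis
      using app q j by (auto simp: bounce_append bounce_free_iff AB_paths_iff)
  qed
  show "inj_on ?f ?S"
  proof (rule inj_onI)
    fix x y assume xy: "x \<in> ?S" "y \<in> ?S" "?f x = ?f y"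
    obtain j C q r j' C' q' r' where x: "x = ((j, C), (q, r))" and y: "y = ((j', C'), (q', r'))"
      by (metis surj_pair)
    have S: "((j, C), (q, r)) \<in> ?S" "((j', C'), (q', r')) \<in> ?S"
      using xy unfolding x y by blast+
    have eq: "q @ r = q' @ r'" using xy(3) by (simp add: x y)
    have "length q = length q'"
      using split[OF S(1)] split[OF S(2)] unfolding eq by (metis linorder_neqE_nat)
    then have "q = q'" "r = r'" using eq by auto
    then show "x = y" unfolding x y
      using split[OF S(1)] split[OF S(2)] by simp
  qed
  show "?f ` ?S = ?T"
  proof (intro equalityI subsetI)
    fix p assume "p \<in> ?f ` ?S"
    then obtain x where x: "x \<in> ?S" "p = ?f x" by (rule imageE)
    obtain j C q r where eq: "x = ((j, C), (q, r))" by (metis surj_pair)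
    have "p = q @ r" using x(2) by (simp add: eq)
    with split[OF x(1)[unfolded eq]] show "p \<in> ?T"
      by (simp add: bounce_free_iff) blast
  next
    fix p assume p: "p \<in> ?T"
    define i where "i = (LEAST i. bounce \<alpha> p i)"
    have i: "bounce \<alpha> p i"
      unfolding i_def by (rule LeastI_ex) (use p in \<open>simp add: bounce_free_iff\<close>)
    have least: "\<not> bounce \<alpha> p i'" if "i' < i" for i'
      using that not_less_Least unfolding i_def by blast
    define q r C j where "q = take i p" and "r = drop i p" and "C = p ! (i - 1)"
      and "j = count_list q North"
    have pqr: "p = q @ r" by (simp add: q_def r_def)
    have i': "0 < i" "i < length p" "p ! i \<noteq> C" "count_list q East = \<alpha> * j" and len: "length q = i"
      using i by (auto simp: bounce_def on_line_def vertex_def C_def q_def j_def)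
    have ne: "q \<noteq> []" "r \<noteq> []" using i' by (auto simp: q_def r_def)
    have cnt: "count_list q East + count_list r East = \<alpha> * k"
      "count_list q North + count_list r North = k"
      using p unfolding pqr by (auto simp: AB_paths_iff)
    have rN: "count_list r North = k - j" using cnt(2) by (simp add: j_def)
    have rE: "count_list r East = \<alpha> * (k - j)" using cnt(1) i'(4) by (simp add: right_diff_distrib')
    \<comment> \<open>A piece with \<open>\<alpha> * j\<close> East and \<open>j\<close> North steps
      is empty for \<open>j = 0\<close>; likewise for \<open>r\<close> and
      \<open>k - j\<close>.\<close>
    have "0 < j" using ne(1) length_eq_count_steps[of q] i'(4) by (cases j) (auto simp: j_def)
    moreover have "j < k" using ne(2) length_eq_count_steps[of r] rN rE by (cases "k - j") auto
    moreover have "last q = C" "hd r = opposite C" "hd q = A" "last r = B"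
    proof -
      show "last q = C" using ne i' by (simp add: last_conv_nth len) (simp add: q_def C_def)
      show "hd r = opposite C" using i' by (simp add: r_def hd_drop_conv_nth) (metis opposite_eq_iff)
      show "hd q = A" "last r = B" using p ne unfolding pqr by (auto simp: AB_paths_iff)
    qed
    \<comment> \<open>Before \<open>i\<close> a bounce of \<open>q\<close> would be an earlier
      bounce of \<open>p\<close>; from \<open>i = length q\<close> on there is no interior vertex of
      \<open>q\<close>.\<close>
    moreover have "\<not> bounce \<alpha> q i'" for i'
      using least[of i'] bounce_append[of i' q \<alpha> r] by (auto simp: len pqr bounce_def)
    ultimately have "((j, C), (q, r)) \<in> ?S"
      using i'(4) rN rE by (auto simp: AB_paths_iff bounce_free_iff j_def)
    then show "p \<in> ?f ` ?S"
      by (rule rev_image_eqI) (simp add: pqr)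
  qed
qed

lemma card_first_bounce:
  "card (AB_paths \<alpha> A B k) = card (bounce_free_AB_paths \<alpha> A B k) +
    (\<Sum>C\<in>UNIV. \<Sum>j\<in>{1..<k}.
       card (bounce_free_AB_paths \<alpha> A C j) * card (AB_paths \<alpha> (opposite C) B (k - j)))"
proof -
  have "card (AB_paths \<alpha> A B k) =
      card (bounce_free_AB_paths \<alpha> A B k) + card {p \<in> AB_paths \<alpha> A B k. \<not> bounce_free \<alpha> p}"
    by (subst card_Int_Diff[OF finite_AB_paths, where B = "Collect (bounce_free \<alpha>)"])
      (simp add: set_diff_eq Int_def)
  also have "card {p \<in> AB_paths \<alpha> A B k. \<not> bounce_free \<alpha> p} =
      (\<Sum>(j, C)\<in>{1..<k} \<times> UNIV.
        card (bounce_free_AB_paths \<alpha> A C j) * card (AB_paths \<alpha> (opposite C) B (k - j)))"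
    unfolding bij_betw_same_card[OF first_bounce_bij_betw, symmetric]
    by (subst card_SigmaI)
      (simp_all add: UNIV_step finite_AB_paths card_cartesian_product case_prod_unfold)
  also have "\<dots> = (\<Sum>C\<in>UNIV. \<Sum>j\<in>{1..<k}.
        card (bounce_free_AB_paths \<alpha> A C j) * card (AB_paths \<alpha> (opposite C) B (k - j)))"
    by (subst sum.cartesian_product[symmetric]) (rule sum.swap)
  finally show ?thesis .
qed

text \<open>Summing over the cut point is a Cauchy product. East is paired with North because the
  step changes at a bounce.\<close>

lemma AB_gf_first_bounce:
  "AB_gf \<alpha> A B = bounce_free_gf \<alpha> A B +
     bounce_free_gf \<alpha> A East * AB_gf \<alpha> North B + bounce_free_gf \<alpha> A North * AB_gf \<alpha> East B"
proof (rule fps_ext)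
  fix n
  have conv: "(bounce_free_gf \<alpha> A C * AB_gf \<alpha> D B) $ n = of_nat (\<Sum>j\<in>{1..<n}.
      card (bounce_free_AB_paths \<alpha> A C j) * card (AB_paths \<alpha> D B (n - j)))" for C D
  proof -
    have "(bounce_free_gf \<alpha> A C * AB_gf \<alpha> D B) $ n =
        (\<Sum>j\<in>{0..n}. bounce_free_gf \<alpha> A C $ j * AB_gf \<alpha> D B $ (n - j))"
      by (rule fps_mult_nth)
    \<comment> \<open>The terms \<open>j = 0\<close> and \<open>j = n\<close> vanish because both
      series have constant term 0.\<close>
    also have "\<dots> = (\<Sum>j\<in>{1..<n}. bounce_free_gf \<alpha> A C $ j * AB_gf \<alpha> D B $ (n - j))"
      by (rule sum.mono_neutral_right) (auto simp: bounce_free_gf_def AB_gf_def)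
    also have "\<dots> = of_nat (\<Sum>j\<in>{1..<n}.
        card (bounce_free_AB_paths \<alpha> A C j) * card (AB_paths \<alpha> D B (n - j)))"
      unfolding of_nat_sum by (rule sum.cong) (auto simp: bounce_free_gf_def AB_gf_def)
    finally show ?thesis .
  qed
  show "AB_gf \<alpha> A B $ n = (bounce_free_gf \<alpha> A B + bounce_free_gf \<alpha> A East * AB_gf \<alpha> North B +
      bounce_free_gf \<alpha> A North * AB_gf \<alpha> East B) $ n"
  proof (cases "n = 0")
    case False
    then show ?thesis
      unfolding fps_add_nth conv
      by (simp add: AB_gf_def bounce_free_gf_def card_first_bounce[of \<alpha> A B n] UNIV_step)
  qed (simp add: AB_gf_def bounce_free_gf_def)
qed

section \<open>Solving the linear system\<close>

text \<open>Cramer's rule for one row \<open>(e, f)\<close> of bounce-free series. The determinant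
  is (D + u)^2 - u^2 (1 - D), which has the factor \<open>D\<close>.\<close>

lemma cramer_first_bounce:
  fixes D u s w e f :: "'a :: idom"
  assumes "s = e * (D + u) + f * (1 - D)" and "w = f * (D + u) + e * u ^ 2"
  shows "e * (D * (D + 2 * u + u ^ 2)) = s * (D + u) - w * (1 - D)"
    and "f * (D * (D + 2 * u + u ^ 2)) = w * (D + u) - s * u ^ 2"
  unfolding assms by (simp_all add: algebra_simps power2_eq_square)

theorem mainTheorem4:
  fixes \<alpha> :: nat and c :: "rat fps"
  assumes "\<alpha> \<ge> 1"
  defines "c \<equiv> fuss_catalan_gf \<alpha>"
  shows "bounce_free_gf \<alpha> East East =
           (of_nat \<alpha> * c - 1) * (c - 1) / ((1 - of_nat \<alpha>) * c ^ 2 + (of_nat \<alpha> + 1) * c - 1)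
       \<and> bounce_free_gf \<alpha> North North =
           (c - 1) ^ 2 / ((1 - of_nat \<alpha>) * c ^ 2 + (of_nat \<alpha> + 1) * c - 1)
       \<and> bounce_free_gf \<alpha> East North =
           c * (c - 1) / ((1 - of_nat \<alpha>) * c ^ 2 + (of_nat \<alpha> + 1) * c - 1)"
proof -
  define T :: "rat fps" where "T = binomial_gf (Suc \<alpha>) 0"
  \<comment> \<open>Since \<open>T * K = c\<close>, multiplication by \<open>D = c * K\<close>
    clears the denominators: the series of all AB-paths become \<open>u\<close>,
    \<open>u ^ 2\<close> and \<open>1 - D\<close>.\<close>
  define K where "K = 1 + of_nat \<alpha> - of_nat \<alpha> * c"
  define D where "D = c * K"
  define u where "u = c - 1"
  define Q where "Q = (1 - of_nat \<alpha>) * c ^ 2 + (of_nat \<alpha> + 1) * c - 1"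
  have TK: "T * K = c" unfolding T_def K_def c_def by (rule binomial_gf_0_eq)
  have Xc: "fps_X * c ^ Suc \<alpha> = u"
    using fuss_catalan_gf_rec[of \<alpha>] unfolding c_def u_def by (metis add_diff_cancel_left')
  have c0: "c $ 0 = 1" by (simp add: c_def fuss_catalan_gf_def)
  have "K $ 0 = 1" "Q $ 0 = 1"
    by (simp_all add: K_def Q_def c0 fps_of_nat[symmetric] fps_power_zeroth)
  then have ne: "c \<noteq> 0" "D \<noteq> 0" "Q \<noteq> 0" using c0 by (auto simp: D_def)
  \<comment> \<open>The denominator of the claim is the determinant of the row system divided by
    \<open>D\<close>.\<close>
  have Q: "Q = D + 2 * u + u ^ 2"
    by (simp add: Q_def D_def K_def u_def algebra_simps power2_eq_square)

  have mixed: "D * AB_gf \<alpha> A B = u" if "A \<noteq> B" for A B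
  proof -
    \<comment> \<open>The extra factor \<open>c\<close> turns the exponent
      \<open>\<alpha> - 1\<close> into \<open>\<alpha>\<close> and is cancelled at the end.\<close>
    have "c * (D * AB_gf \<alpha> A B) = c * (T * K) * (fps_X * (c * c ^ (\<alpha> - 1)))"
      unfolding AB_gf_mixed[OF assms(1) that] binomial_gf_eq_power[of \<alpha> "\<alpha> - 1"]
      by (simp add: D_def T_def c_def[symmetric] mult_ac)
    also have "c * c ^ (\<alpha> - 1) = c ^ \<alpha>" using assms(1) by (simp flip: power_Suc)
    also have "c * (T * K) * (fps_X * c ^ \<alpha>) = c * (fps_X * c ^ Suc \<alpha>)"
      unfolding TK by (simp add: mult_ac)
    finally show ?thesis using ne(1) unfolding Xc by simp
  qed
  have NN: "D * AB_gf \<alpha> North North = u ^ 2"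
  proof -
    have "D * AB_gf \<alpha> North North = c * (T * K) * (fps_X ^ 2 * c ^ (2 * \<alpha>))"
      unfolding AB_gf_North_North[OF assms(1)] binomial_gf_eq_power[of \<alpha> "2 * \<alpha>"]
      by (simp add: D_def T_def c_def[symmetric] mult_ac)
    also have "\<dots> = (fps_X * c ^ Suc \<alpha>) ^ 2"
      unfolding TK power_even_eq by (simp add: power_mult_distrib) (simp add: power2_eq_square mult_ac)
    finally show ?thesis unfolding Xc .
  qed
  have EE: "D * AB_gf \<alpha> East East = 1 - D"
  proof -
    have "AB_gf \<alpha> East East =
        T - 1 - AB_gf \<alpha> East North - AB_gf \<alpha> North East - AB_gf \<alpha> North North"
      using AB_gf_total[of \<alpha>] by (simp add: T_def algebra_simps)
    then have "D * AB_gf \<alpha> East East =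
        D * (T - 1 - AB_gf \<alpha> East North - AB_gf \<alpha> North East - AB_gf \<alpha> North North)"
      by (rule arg_cong)
    also have "\<dots> = c * (T * K) - D - D * AB_gf \<alpha> East North
        - D * AB_gf \<alpha> North East - D * AB_gf \<alpha> North North"
      by (simp add: algebra_simps D_def)
    also have "\<dots> = c * c - D - u - u - u ^ 2" by (simp add: mixed NN TK)
    \<comment> \<open>Here c^2 = (1 + u)^2 cancels everything but 1 and \<open>D\<close>.\<close>
    also have "\<dots> = 1 - D" by (simp add: u_def algebra_simps power2_eq_square)
    finally show ?thesis .
  qed

  have row_E: "D * AB_gf \<alpha> A East =
      bounce_free_gf \<alpha> A East * (D + u) + bounce_free_gf \<alpha> A North * (1 - D)" for A
  proof -
    have "D * AB_gf \<alpha> A East = bounce_free_gf \<alpha> A East * (D + D * AB_gf \<alpha> North East) +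
        bounce_free_gf \<alpha> A North * (D * AB_gf \<alpha> East East)"
      by (subst AB_gf_first_bounce) (simp add: algebra_simps)
    then show ?thesis by (simp add: mixed EE)
  qed
  have row_N: "D * AB_gf \<alpha> A North =
      bounce_free_gf \<alpha> A North * (D + u) + bounce_free_gf \<alpha> A East * u ^ 2" for A
  proof -
    have "D * AB_gf \<alpha> A North = bounce_free_gf \<alpha> A North * (D + D * AB_gf \<alpha> East North) +
        bounce_free_gf \<alpha> A East * (D * AB_gf \<alpha> North North)"
      by (subst AB_gf_first_bounce) (simp add: algebra_simps)
    then show ?thesis by (simp add: mixed NN)
  qed
  note sol = cramer_first_bounce[OF row_E row_N, folded Q]
  \<comment> \<open>In each of the three cases the right side of Cramer's rule also has the factor
    \<open>D\<close>, so \<open>D\<close> cancels and only \<open>Q\<close> remains as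
    denominator.\<close>
  have "D * (bounce_free_gf \<alpha> East East * Q) = D * (1 - D)"
    using sol(1)[of East] by (simp add: EE mixed algebra_simps)
  moreover have "D * (bounce_free_gf \<alpha> North North * Q) = D * u ^ 2"
    using sol(2)[of North] by (simp add: NN mixed algebra_simps)
  moreover have "D * (bounce_free_gf \<alpha> East North * Q) = D * (c * u)"
    using sol(2)[of East] by (simp add: EE mixed u_def algebra_simps power2_eq_square)
  ultimately have sol': "bounce_free_gf \<alpha> East East * Q = 1 - D"
    "bounce_free_gf \<alpha> North North * Q = u ^ 2" "bounce_free_gf \<alpha> East North * Q = c * u"
    using ne(2) by simp_all
  have "1 - D = (of_nat \<alpha> * c - 1) * (c - 1)"
    by (simp add: D_def K_def algebra_simps)
  moreover have "f = f * Q / Q" for f using ne(3) by simp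
  ultimately show ?thesis
    using sol' unfolding Q_def[symmetric] u_def by metis
qed

end
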